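(* There is no constant $C>0$ such that for all $u\in\mathcal{C}^2_c(\mathbb{R}^2)$ and all points $p\in\mathbb{R}^2$ $$ \left|\frac{\partial u}{\partial x}(p)\right|\leq C\left(M\left(\frac{\partial^2 u}{\partial x^2}\right)(p)\right)^{1/2}\bigl(Mu(p)\bigr)^{1/2}, $$ where $(x,y)$ denote the coordinates in $\mathbb{R}^2$ and $M$ is the Hardy--Littlewood maximal operator.
   Context: $\mathcal{C}^{2}_c(\mathbb{R}^2)$ is the space of twice continuously differentiable real functions with compact support. The Hardy--Littlewood maximal operator is $$ Mu(p):=\sup_{B\ni p}\frac{1}{|B|}\int_B|u(q)|\,dq, $$ the supremum being taken over all balls $B$ containing $p$. *)

theory Defs
  imports "HOL-Analysis.Analysis"
begin

definition has_partial :: "'n::finite \<Rightarrow> (real ^ 'n \<Rightarrow> real) \<Rightarrow> real ^ 'n \<Rightarrow> bool" where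
  "has_partial i u p \<longleftrightarrow> (\<lambda>t. u (p + t *\<^sub>R axis i 1)) differentiable at 0"

definition partial :: "'n::finite \<Rightarrow> (real ^ 'n \<Rightarrow> real) \<Rightarrow> real ^ 'n \<Rightarrow> real" where
  "partial i u p = deriv (\<lambda>t. u (p + t *\<^sub>R axis i 1)) 0"

primrec cont_diff :: "nat \<Rightarrow> (real ^ 'n::finite \<Rightarrow> real) \<Rightarrow> bool" where
  "cont_diff 0 u \<longleftrightarrow> continuous_on UNIV u"
| "cont_diff (Suc k) u \<longleftrightarrow>
     continuous_on UNIV u \<and> (\<forall>i. (\<forall>p. has_partial i u p) \<and> cont_diff k (partial i u))"

definition C2c :: "(real ^ 'n::finite \<Rightarrow> real) set" where
  "C2c = {u. cont_diff 2 u \<and> compact (closure {p. u p \<noteq> 0})}"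

text \<open>The uncentred maximal function, with values in \<open>[0, \<infinity>]\<close>. The supremum ranges over the open
  balls; the closed balls give the same value, and \<open>p \<in> ball c r\<close> forces \<open>r > 0\<close>.\<close>

definition maximal :: "(real ^ 'n::finite \<Rightarrow> real) \<Rightarrow> real ^ 'n \<Rightarrow> ennreal" where
  "maximal u p = (SUP (c, r) \<in> {(c, r). p \<in> ball c r}.
     (\<integral>\<^sup>+ q \<in> ball c r. ennreal \<bar>u q\<bar> \<partial>lebesgue) / emeasure lebesgue (ball c r))"

text \<open>On the functions of interest the maximal function is finite, so that \<open>enn2real\<close> loses nothing.\<close>

lemma maximal_le:
  assumes "\<And>q. \<bar>u q\<bar> \<le> B"
  shows "maximal u p \<le> ennreal B"
  unfolding maximal_def
proof (rule SUP_least, clarify)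
  fix c and r :: real
  assume "p \<in> ball c r"
  then have r: "r > 0"
    using zero_le_dist[of c p] unfolding mem_ball by linarith
  have "(\<integral>\<^sup>+ q \<in> ball c r. ennreal \<bar>u q\<bar> \<partial>lebesgue) \<le> (\<integral>\<^sup>+ q \<in> ball c r. ennreal B \<partial>lebesgue)"
    by (intro nn_integral_mono mult_right_mono ennreal_leI assms) auto
  also have "\<dots> = ennreal B * emeasure lebesgue (ball c r)"
    by (simp add: nn_integral_cmult_indicator)
  finally have le: "(\<integral>\<^sup>+ q \<in> ball c r. ennreal \<bar>u q\<bar> \<partial>lebesgue)
      \<le> ennreal B * emeasure lebesgue (ball c r)" .
  have "emeasure lebesgue (ball c r) \<noteq> 0" "emeasure lebesgue (ball c r) \<noteq> \<infinity>"
    using r emeasure_lborel_ball_finite[of c r] content_ball_pos[of r c]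
    by (auto simp: measure_def)
  then show "(\<integral>\<^sup>+ q \<in> ball c r. ennreal \<bar>u q\<bar> \<partial>lebesgue) / emeasure lebesgue (ball c r) \<le> ennreal B"
    using divide_right_mono_ennreal[OF le, of "emeasure lebesgue (ball c r)"]
    by (simp add: ennreal_mult_divide_eq)
qed

lemma maximal_finite:
  assumes "continuous_on UNIV u" "compact K" "\<And>q. q \<notin> K \<Longrightarrow> u q = 0"
  shows "maximal u p < \<infinity>"
proof -
  have "bounded (u ` K)"
    using assms by (meson compact_continuous_image compact_imp_bounded continuous_on_subset subset_UNIV)
  then obtain B where B: "\<And>q. q \<in> K \<Longrightarrow> \<bar>u q\<bar> \<le> B"
    by (auto simp: bounded_iff)
  have "\<bar>u q\<bar> \<le> max B 0" for q
    using B[of q] assms(3)[of q] by (cases "q \<in> K") auto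
  then have "maximal u p \<le> ennreal (max B 0)"
    by (rule maximal_le)
  then show ?thesis
    by (simp add: ennreal_less_top le_less_trans)
qed

lemma partial_eq_0_outside:
  fixes u :: "real ^ 'n::finite \<Rightarrow> real"
  assumes "closed K" "\<And>q. q \<notin> K \<Longrightarrow> u q = 0" "p \<notin> K"
  shows "partial i u p = 0"
proof -
  have "((\<lambda>t::real. p + t *\<^sub>R axis i 1) \<longlongrightarrow> p + 0 *\<^sub>R axis i 1) (nhds 0)"
    by (intro tendsto_intros filterlim_ident)
  moreover have "eventually (\<lambda>q. q \<in> - K) (nhds (p + 0 *\<^sub>R axis i 1))"
    using assms by (intro eventually_nhds_in_open) auto
  ultimately have "eventually (\<lambda>t::real. p + t *\<^sub>R axis i 1 \<in> - K) (nhds 0)"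
    by (rule eventually_compose_filterlim[rotated])
  then have "eventually (\<lambda>t::real. u (p + t *\<^sub>R axis i 1) = 0) (nhds 0)"
    by eventually_elim (use assms in auto)
  then have "deriv (\<lambda>t::real. u (p + t *\<^sub>R axis i 1)) 0 = deriv (\<lambda>t::real. 0) (0::real)"
    by (intro deriv_cong_ev) auto
  then show ?thesis
    by (simp add: partial_def)
qed

lemma maximal_finite_C2c:
  assumes "u \<in> C2c"
  shows "maximal u p < \<infinity>" and "maximal (partial i (partial j u)) p < \<infinity>"
proof -
  define K where "K = closure {p. u p \<noteq> 0}"
  have K: "compact K" "closed K"
    using assms by (auto simp: C2c_def K_def)
  have u0: "u q = 0" if "q \<notin> K" for q
    using that closure_subset[of "{p. u p \<noteq> 0}"] by (auto simp: K_def)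
  have c: "continuous_on UNIV u" "continuous_on UNIV (partial i (partial j u))"
    using assms by (simp_all add: C2c_def numeral_2_eq_2)
  show "maximal u p < \<infinity>"
    using c(1) K(1) u0 by (rule maximal_finite)
  show "maximal (partial i (partial j u)) p < \<infinity>"
  proof (rule maximal_finite[OF c(2) K(1)])
    have "partial j u q = 0" if "q \<notin> K" for q
      using K(2) u0 that by (rule partial_eq_0_outside)
    then show "partial i (partial j u) q = 0" if "q \<notin> K" for q
      using partial_eq_0_outside[OF K(2) _ that] by blast
  qed
qed

end

(* Take u(x, y) = f(x) g(y / e) with f'(0) = 1, where both f and f'' are bounded by a multiple of |x|.
   If a ball of radius r contains the origin, then |x| <= 2 r on it, and it meets the strip |y| <= e
   in a set of measure at most 4 r e. So its averages of |u| and of |u_xx| are O(e), uniformly in r,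
   while u_x(0) = 1. *)
theory Submission
  imports Defs
begin

section \<open>Products of one-variable functions and their partial derivatives\<close>

definition tensor :: "(real \<Rightarrow> real) \<Rightarrow> (real \<Rightarrow> real) \<Rightarrow> real ^ 2 \<Rightarrow> real" where
  "tensor f g p = f (p $ 1) * g (p $ 2)"

lemma tensor_has_partial_1:
  assumes "\<And>x. (f has_real_derivative f' x) (at x)"
  shows "has_partial 1 (tensor f g) p" and "partial 1 (tensor f g) = tensor f' g"
proof -
  have *: "((\<lambda>t. tensor f g (p + t *\<^sub>R axis 1 1)) has_real_derivative tensor f' g p) (at 0)" for p
    unfolding tensor_def
    by (auto intro!: derivative_eq_intros DERIV_chain2[of f] assms simp: axis_def)
  show "has_partial 1 (tensor f g) p"
    using *[of p] by (auto simp: has_partial_def real_differentiable_def)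
  show "partial 1 (tensor f g) = tensor f' g"
    using * by (auto simp: partial_def fun_eq_iff intro: DERIV_imp_deriv)
qed

lemma tensor_has_partial_2:
  assumes "\<And>y. (g has_real_derivative g' y) (at y)"
  shows "has_partial 2 (tensor f g) p" and "partial 2 (tensor f g) = tensor f g'"
proof -
  have *: "((\<lambda>t. tensor f g (p + t *\<^sub>R axis 2 1)) has_real_derivative tensor f g' p) (at 0)" for p
    unfolding tensor_def
    by (auto intro!: derivative_eq_intros DERIV_chain2[of g] assms simp: axis_def)
  show "has_partial 2 (tensor f g) p"
    using *[of p] by (auto simp: has_partial_def real_differentiable_def)
  show "partial 2 (tensor f g) = tensor f g'"
    using * by (auto simp: partial_def fun_eq_iff intro: DERIV_imp_deriv)
qed

lemma continuous_on_tensor: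
  assumes "continuous_on UNIV f" "continuous_on UNIV g"
  shows "continuous_on UNIV (tensor f g)"
  unfolding tensor_def
  by (intro continuous_intros continuous_on_compose2[OF assms(1)] continuous_on_compose2[OF assms(2)]) auto

text \<open>Every partial derivative of a product is again a product, so the iterated partials up to
  order two are built from \<open>f\<close>, \<open>f'\<close>, \<open>f''\<close> and
  \<open>g\<close>, \<open>g'\<close>, \<open>g''\<close>, all continuous. The support lies in the
  square of half-side \<open>R\<close>.\<close>

lemma tensor_in_C2c:
  assumes f: "\<And>x. (f has_real_derivative f' x) (at x)"
    and f': "\<And>x. (f' has_real_derivative f'' x) (at x)" and f'': "continuous_on UNIV f''"
    and g: "\<And>y. (g has_real_derivative g' y) (at y)"
    and g': "\<And>y. (g' has_real_derivative g'' y) (at y)" and g'': "continuous_on UNIV g''"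
    and supp: "\<And>x. \<bar>x\<bar> > R \<Longrightarrow> f x = 0" "\<And>y. \<bar>y\<bar> > R \<Longrightarrow> g y = 0"
  shows "tensor f g \<in> C2c"
proof -
  have c: "continuous_on UNIV f" "continuous_on UNIV f'" "continuous_on UNIV g" "continuous_on UNIV g'"
    using DERIV_continuous_on[of UNIV f f'] DERIV_continuous_on[of UNIV f' f'']
      DERIV_continuous_on[of UNIV g g'] DERIV_continuous_on[of UNIV g' g''] f f' g g' by simp_all
  have "cont_diff 2 (tensor f g)"
    by (auto simp: numeral_2_eq_2 forall_2 continuous_on_tensor c f'' g''
        tensor_has_partial_1[OF f] tensor_has_partial_1[OF f']
        tensor_has_partial_2[OF g] tensor_has_partial_2[OF g'])
  moreover have "{p. tensor f g p \<noteq> 0} \<subseteq> cbox (\<chi> i. - R) (\<chi> i. R)"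
    using supp by (force simp: tensor_def mem_box_cart forall_2 not_less abs_le_iff)
  then have "compact (closure {p. tensor f g p \<noteq> 0})"
    by (metis bounded_cbox bounded_subset compact_closure)
  ultimately show ?thesis
    by (simp add: C2c_def)
qed

section \<open>Areas of rectangles and balls, and the maximal function of a function supported in a
  strip\<close>

lemma emeasure_cbox_2:
  fixes a b :: "real ^ 2"
  assumes "a $ 1 \<le> b $ 1" "a $ 2 \<le> b $ 2"
  shows "emeasure lebesgue (cbox a b) = ennreal ((b $ 1 - a $ 1) * (b $ 2 - a $ 2))"
proof -
  have "a \<in> cbox a b"
    using assms by (simp add: mem_box_cart forall_2)
  then have "cbox a b \<noteq> {}"
    by blast
  then have "measure lborel (cbox a b) = (b $ 1 - a $ 1) * (b $ 2 - a $ 2)"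
    by (simp add: content_cbox_cart UNIV_2)
  then show ?thesis
    using emeasure_eq_ennreal_measure[of lborel "cbox a b"] emeasure_lborel_cbox_finite[of a b] by simp
qed

text \<open>The ball contains the concentric square of side \<open>r\<close>, whose half-diagonal is
  r / sqrt 2 < r. The constant 1 instead of pi suffices, since only the order r^2 matters
  below.\<close>

lemma emeasure_ball_2_ge:
  fixes c :: "real ^ 2"
  assumes "r > 0"
  shows "emeasure lebesgue (ball c r) \<ge> ennreal (r\<^sup>2)"
proof -
  define Q where "Q = cbox (\<chi> i. c $ i - r / 2) (\<chi> i. c $ i + r / 2)"
  have "Q \<subseteq> ball c r"
  proof
    fix q assume "q \<in> Q"
    then have "\<bar>c $ i - q $ i\<bar> \<le> r / 2" for i
      unfolding Q_def mem_box_cart vec_lambda_beta abs_le_iff by (smt (verit))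
    then have "(c $ i - q $ i)\<^sup>2 \<le> (r / 2)\<^sup>2" for i
      by (metis abs_ge_zero power2_abs power_mono)
    from this[of 1] this[of 2] have "(c $ 1 - q $ 1)\<^sup>2 + (c $ 2 - q $ 2)\<^sup>2 < r\<^sup>2"
      using zero_less_power[OF assms, of 2] unfolding power_divide power2_eq_square[of 2] by linarith
    then have "sqrt ((c $ 1 - q $ 1)\<^sup>2 + (c $ 2 - q $ 2)\<^sup>2) < r"
      using assms by (simp add: real_less_lsqrt)
    then show "q \<in> ball c r"
      by (simp add: dist_norm norm_vec_def L2_set_def sum_2)
  qed
  moreover have "emeasure lebesgue Q = ennreal (r\<^sup>2)"
    using assms unfolding Q_def by (subst emeasure_cbox_2) (auto simp: power2_eq_square)
  ultimately show ?thesis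
    by (metis emeasure_mono fmeasurableD lmeasurable_ball)
qed

text \<open>A ball of radius \<open>r\<close> around \<open>c\<close> that contains 0 has |c| < r,
  so its first coordinates are below 2 r in absolute value and \<open>v\<close> is at most 2 r A on
  it. The linear bound in the first coordinate thus supplies one factor \<open>r\<close> and the
  width of the rectangle \<open>S\<close> another. Together they cancel the area of the ball, which
  leaves a bound independent of \<open>r\<close>.\<close>

lemma maximal_strip_le:
  fixes v :: "real ^ 2 \<Rightarrow> real"
  assumes "\<epsilon> \<ge> 0" "A \<ge> 0" and bound: "\<And>q. \<bar>q $ 2\<bar> \<le> \<epsilon> \<Longrightarrow> \<bar>v q\<bar> \<le> A * \<bar>q $ 1\<bar>"
    and zero: "\<And>q. \<bar>q $ 2\<bar> > \<epsilon> \<Longrightarrow> v q = 0"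
  shows "maximal v 0 \<le> ennreal (8 * A * \<epsilon>)"
  unfolding maximal_def
proof (rule SUP_least, clarify)
  fix c :: "real ^ 2" and r :: real
  assume "0 \<in> ball c r"
  then have nc: "norm c < r" and r: "r > 0"
    using norm_ge_zero[of c] by (auto simp del: norm_ge_zero)
  define S :: "(real ^ 2) set" where
    "S = cbox (vector [c $ 1 - r, - \<epsilon>]) (vector [c $ 1 + r, \<epsilon>])"
  \<comment> \<open>\<open>S\<close> has sides 2 r and 2 \<epsilon> and covers the part of the ball
    inside the strip; elsewhere the left side is 0.\<close>
  have "ennreal \<bar>v q\<bar> * indicator (ball c r) q \<le> ennreal (2 * r * A) * indicator S q" for q
  proof (cases "q \<in> ball c r \<and> \<bar>q $ 2\<bar> \<le> \<epsilon>")
    case True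
    have n: "\<bar>c $ 1 - q $ 1\<bar> < r"
      using True component_le_norm_cart[of "c - q" 1] by (simp add: dist_norm)
    moreover have "\<bar>c $ 1\<bar> < r"
      using nc component_le_norm_cart[of c 1] by simp
    ultimately have "A * \<bar>q $ 1\<bar> \<le> A * (2 * r)"
      using assms(2) by (intro mult_left_mono) auto
    then have "\<bar>v q\<bar> \<le> 2 * r * A"
      using bound[of q] True by (simp add: mult_ac)
    moreover have "q \<in> S"
      using n True by (auto simp: S_def mem_box_cart forall_2)
    ultimately show ?thesis
      using True by (simp add: ennreal_leI)
  next
    case False
    then show ?thesis
      using zero[of q] by (auto simp: indicator_def)
  qed
  then have "(\<integral>\<^sup>+ q \<in> ball c r. ennreal \<bar>v q\<bar> \<partial>lebesgue) \<le> (\<integral>\<^sup>+ q \<in> S. ennreal (2 * r * A) \<partial>lebesgue)"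
    by (intro nn_integral_mono)
  also have "\<dots> = ennreal (2 * r * A) * emeasure lebesgue S"
    by (simp add: nn_integral_cmult_indicator S_def)
  also have "emeasure lebesgue S = ennreal (4 * r * \<epsilon>)"
    using r assms(1) unfolding S_def by (subst emeasure_cbox_2) auto
  also have "ennreal (2 * r * A) * ennreal (4 * r * \<epsilon>) = ennreal (8 * A * \<epsilon>) * ennreal (r\<^sup>2)"
    using r assms(1,2) by (simp add: ennreal_mult[symmetric] power2_eq_square mult_ac)
  also have "\<dots> \<le> ennreal (8 * A * \<epsilon>) * emeasure lebesgue (ball c r)"
    using r by (intro mult_left_mono emeasure_ball_2_ge) auto
  finally have le: "(\<integral>\<^sup>+ q \<in> ball c r. ennreal \<bar>v q\<bar> \<partial>lebesgue)
      \<le> ennreal (8 * A * \<epsilon>) * emeasure lebesgue (ball c r)" .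
  have "emeasure lebesgue (ball c r) \<noteq> 0" "emeasure lebesgue (ball c r) \<noteq> \<infinity>"
    using r emeasure_lborel_ball_finite[of c r] content_ball_pos[of r c]
    by (auto simp: measure_def)
  then show "(\<integral>\<^sup>+ q \<in> ball c r. ennreal \<bar>v q\<bar> \<partial>lebesgue) / emeasure lebesgue (ball c r)
      \<le> ennreal (8 * A * \<epsilon>)"
    using divide_right_mono_ennreal[OF le, of "emeasure lebesgue (ball c r)"]
    by (simp add: ennreal_mult_divide_eq)
qed

section \<open>A piecewise polynomial bump function\<close>

lemma has_real_derivative_max_0_power:
  "((\<lambda>x::real. max 0 x ^ Suc (Suc n)) has_real_derivative real (Suc (Suc n)) * max 0 x ^ Suc n) (at x)"
proof -
  consider "x < 0" | "x > 0" | "x = 0" by linarith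
  then show ?thesis
  proof cases
    case 1
    show ?thesis
      by (rule has_field_derivative_transform_within_open[where f = "\<lambda>_. 0" and S = "{..<0}"])
        (use 1 in auto)
  next
    case 2
    show ?thesis
      by (rule has_field_derivative_transform_within_open[where f = "\<lambda>x. x ^ Suc (Suc n)" and S = "{0<..}"])
        (use 2 DERIV_pow[of "Suc (Suc n)" x UNIV] in \<open>auto simp: max_def simp del: power_Suc\<close>)
  next
    case 3
    \<comment> \<open>At the kink the difference quotient is itself a power of the positive part, of
      exponent \<open>Suc n\<close>; this exponent is positive, so the quotient tends to 0.\<close>
    have "((\<lambda>h::real. max 0 h ^ Suc n) \<longlongrightarrow> max 0 0 ^ Suc n) (at 0)"
      by (intro tendsto_intros)
    then have "((\<lambda>h::real. max 0 h ^ Suc n) \<longlongrightarrow> 0) (at 0)"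
      by simp
    moreover have "eventually (\<lambda>h::real. max 0 h ^ Suc n = (max 0 (0 + h) ^ Suc (Suc n) - max 0 0 ^ Suc (Suc n)) / h) (at 0)"
      unfolding eventually_at by (rule exI[of _ 1]) (auto simp: max_def)
    ultimately show ?thesis
      unfolding 3 DERIV_def by (simp add: tendsto_cong)
  qed
qed

text \<open>Differentiating lowers \<open>n\<close> by one and brings out a polynomial factor, so
  all derivatives needed stay explicit. The exponent 3 is the smallest positive one for which this
  function is twice continuously differentiable.\<close>

definition bump :: "nat \<Rightarrow> real \<Rightarrow> real" where
  "bump n x = max 0 (1 - x\<^sup>2) ^ n"

lemma bump_has_real_derivative:
  "(bump (Suc (Suc n)) has_real_derivative - 2 * real (Suc (Suc n)) * x * bump (Suc n) x) (at x)"
proof -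
  have "((\<lambda>x::real. 1 - x\<^sup>2) has_real_derivative - 2 * x) (at x)"
    by (auto intro!: derivative_eq_intros)
  from DERIV_chain2[OF has_real_derivative_max_0_power this] show ?thesis
    unfolding bump_def by (rule DERIV_cong) (simp only: mult_ac)
qed

text \<open>Chain-rule forms with numeral exponents, so that the derivatives of \<open>f\<close>,
  \<open>f'\<close>, \<open>g\<close> and \<open>g'\<close> in the final proof come out of
  \<open>derivative_eq_intros\<close>.\<close>

lemma
  assumes "(h has_real_derivative D) (at x within S)"
  shows bump_2_has_real_derivative [derivative_intros]:
      "((\<lambda>x. bump 2 (h x)) has_real_derivative - 4 * h x * bump 1 (h x) * D) (at x within S)"
    and bump_3_has_real_derivative [derivative_intros]:
      "((\<lambda>x. bump 3 (h x)) has_real_derivative - 6 * h x * bump 2 (h x) * D) (at x within S)"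
  using DERIV_chain2[OF bump_has_real_derivative[of 0] assms]
    DERIV_chain2[OF bump_has_real_derivative[of 1] assms]
  by (simp_all add: numeral_2_eq_2 numeral_3_eq_3)

lemma continuous_on_bump [continuous_intros]:
  "continuous_on S h \<Longrightarrow> continuous_on S (\<lambda>x. bump n (h x))"
  unfolding bump_def by (intro continuous_intros)

lemma bump_nonneg: "bump n x \<ge> 0"
  by (simp add: bump_def)

lemma bump_le_1: "bump n x \<le> 1"
  by (simp add: bump_def power_le_one)

text \<open>The exponent is a successor because \<open>bump 0\<close> is constantly 1, by the
  convention 0^0 = 1.\<close>

lemma bump_eq_0: "\<bar>x\<bar> \<ge> 1 \<Longrightarrow> bump (Suc n) x = 0"
  using abs_le_square_iff[of 1 x] by (simp add: bump_def)

section \<open>The counterexample for a given constant\<close>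

theorem mainTheorem2:
  shows "\<not> (\<exists>C>0. \<forall>u \<in> (C2c :: (real ^ 2 \<Rightarrow> real) set). \<forall>p.
    \<bar>partial 1 u p\<bar>
      \<le> C * sqrt (enn2real (maximal (partial 1 (partial 1 u)) p)) * sqrt (enn2real (maximal u p)))"
proof
  assume "\<exists>C>0. \<forall>u \<in> (C2c :: (real ^ 2 \<Rightarrow> real) set). \<forall>p.
    \<bar>partial 1 u p\<bar>
      \<le> C * sqrt (enn2real (maximal (partial 1 (partial 1 u)) p)) * sqrt (enn2real (maximal u p))"
  then obtain C where "C > 0" and C: "\<And>u p. u \<in> (C2c :: (real ^ 2 \<Rightarrow> real) set) \<Longrightarrow> \<bar>partial 1 u p\<bar>
      \<le> C * sqrt (enn2real (maximal (partial 1 (partial 1 u)) p)) * sqrt (enn2real (maximal u p))"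
    by blast
  \<comment> \<open>The strip has half-width 1 / k. The assumed inequality will give 1 \<le> 400 C /
    k, which this choice of \<open>k\<close> violates.\<close>
  define k where "k = 1 + 400 * C"
  have "k > 1"
    using \<open>C > 0\<close> by (simp add: k_def)
  \<comment> \<open>As \<open>f\<close> is odd, so is its second derivative; both therefore carry a
    factor \<open>x\<close>, while \<open>f'\<close> is 1 at 0.\<close>
  define f where "f x = x * bump 3 x" for x
  define f' where "f' x = bump 3 x - 6 * x\<^sup>2 * bump 2 x" for x
  define f'' where "f'' x = x * (24 * x\<^sup>2 * bump 1 x - 18 * bump 2 x)" for x
  define g where "g y = bump 3 (k * y)" for y
  define g' where "g' y = - 6 * k\<^sup>2 * y * bump 2 (k * y)" for y
  define g'' where "g'' y = 24 * k ^ 4 * y\<^sup>2 * bump 1 (k * y) - 6 * k\<^sup>2 * bump 2 (k * y)" for y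
  have df: "(f has_real_derivative f' x) (at x)" for x
    unfolding f_def f'_def
    by (rule derivative_eq_intros refl)+ (simp add: numeral_eq_Suc algebra_simps)
  have df': "(f' has_real_derivative f'' x) (at x)" for x
    unfolding f'_def f''_def
    by (rule derivative_eq_intros refl)+ (simp add: numeral_eq_Suc algebra_simps)
  have dg: "(g has_real_derivative g' y) (at y)" for y
    unfolding g_def g'_def
    by (rule derivative_eq_intros refl)+ (simp add: numeral_eq_Suc algebra_simps)
  have dg': "(g' has_real_derivative g'' y) (at y)" for y
    unfolding g'_def g''_def
    by (rule derivative_eq_intros refl)+ (simp add: numeral_eq_Suc algebra_simps)
  have g0: "g y = 0" if "\<bar>y\<bar> > 1 / k" for y
    using that \<open>k > 1\<close> bump_eq_0[of "k * y" 2]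
    by (simp add: g_def abs_mult field_simps numeral_3_eq_3 numeral_2_eq_2)
  have g1: "\<bar>g y\<bar> \<le> 1" for y
    using bump_nonneg bump_le_1 by (simp add: g_def)
  define u where "u = tensor f g"
  have "u \<in> C2c"
    unfolding u_def
  \<comment> \<open>\<open>R = 1\<close> serves both factors: \<open>g\<close> vanishes beyond 1 /
    k, which is less than 1.\<close>
  proof (rule tensor_in_C2c[OF df df' _ dg dg', where R = 1])
    show "continuous_on UNIV f''" "continuous_on UNIV g''"
      unfolding f''_def g''_def by (intro continuous_intros)+
    show "f x = 0" if "\<bar>x\<bar> > 1" for x
      using that bump_eq_0[of x 2] by (simp add: f_def numeral_3_eq_3 numeral_2_eq_2)
    show "g y = 0" if "\<bar>y\<bar> > 1" for y
      using that \<open>k > 1\<close> by (intro g0) (smt (verit) divide_le_eq_1)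
  qed
  have u1: "partial 1 u = tensor f' g" "partial 1 (tensor f' g) = tensor f'' g"
    unfolding u_def using tensor_has_partial_1(2) df df' by blast+
  have strip: "maximal (tensor h g) 0 \<le> ennreal (8 * A / k)"
    if "A \<ge> 0" and h: "\<And>x. \<bar>h x\<bar> \<le> A * \<bar>x\<bar>" for h A
  proof -
    have "maximal (tensor h g) 0 \<le> ennreal (8 * A * (1 / k))"
    proof (rule maximal_strip_le)
      show "\<bar>tensor h g q\<bar> \<le> A * \<bar>q $ 1\<bar>" for q
        using mult_mono[OF h[of "q $ 1"] g1[of "q $ 2"]] that(1) by (simp add: tensor_def abs_mult)
    qed (use \<open>k > 1\<close> that g0 in \<open>auto simp: tensor_def\<close>)
    then show ?thesis
      by simp
  qed
  have "\<bar>f x\<bar> \<le> 1 * \<bar>x\<bar>" for x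
    using mult_left_mono[OF bump_le_1[of 3 x], of "\<bar>x\<bar>"] bump_nonneg[of 3 x] by (simp add: f_def abs_mult)
  then have "maximal u 0 \<le> ennreal (8 / k)"
    using strip[of 1 f] by (simp add: u_def)
  then have m0: "enn2real (maximal u 0) \<le> 8 / k"
    using \<open>k > 1\<close> by (intro enn2real_leI) auto
  have "\<bar>f'' x\<bar> \<le> 42 * \<bar>x\<bar>" for x
  proof -
    have "\<bar>x\<^sup>2 * bump 1 x\<bar> \<le> 1"
    proof (cases "\<bar>x\<bar> \<ge> 1")
      case True
      then show ?thesis
        using bump_eq_0[of x 0] by simp
    next
      case False
      then have "x\<^sup>2 \<le> 1"
        by (simp add: abs_square_le_1)
      then show ?thesis
        using bump_nonneg[of 1 x] bump_le_1[of 1 x] by (simp add: abs_mult mult_le_one)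
    qed
    then have "\<bar>24 * x\<^sup>2 * bump 1 x - 18 * bump 2 x\<bar> \<le> 42"
      using bump_nonneg[of 2 x] bump_le_1[of 2 x] by linarith
    from mult_left_mono[OF this, of "\<bar>x\<bar>"] show ?thesis
      by (simp add: f''_def abs_mult)
  qed
  then have "maximal (partial 1 (partial 1 u)) 0 \<le> ennreal (8 * 42 / k)"
    unfolding u1 by (intro strip) auto
  then have m2: "enn2real (maximal (partial 1 (partial 1 u)) 0) \<le> 400 / k"
    using \<open>k > 1\<close> by (intro enn2real_leI) (auto elim!: order_trans intro!: ennreal_leI divide_right_mono)
  have "1 = \<bar>partial 1 u 0\<bar>"
    unfolding u1 by (simp add: tensor_def f'_def g_def bump_def)
  also have "\<dots> \<le> C * sqrt (enn2real (maximal (partial 1 (partial 1 u)) 0)) * sqrt (enn2real (maximal u 0))"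
    using \<open>u \<in> C2c\<close> by (rule C)
  \<comment> \<open>Both 8 / k and 8 * 42 / k = 336 / k are relaxed to 400 / k, so that the two
    square roots multiply to 400 / k.\<close>
  also have "\<dots> \<le> C * sqrt (400 / k) * sqrt (400 / k)"
    using \<open>C > 0\<close> \<open>k > 1\<close> m0 m2
    by (intro mult_mono real_sqrt_le_mono) (auto elim!: order_trans intro!: divide_right_mono)
  also have "\<dots> = 400 * C / k"
    using \<open>k > 1\<close> by (simp add: mult.assoc)
  also have "\<dots> < 1"
    using \<open>C > 0\<close> by (simp add: k_def)
  finally show False
    by simp
qed

end
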